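(* Let $n\ge 1$ and let $a=a_1a_2\cdots a_n$ be a signed permutation on $[n]$. Then $$d_r(a)\geq \frac{2n+1-C(p_r\tilde{s})}{2}.$$
   Context: A signed permutation on $[n]=\{1,\dots,n\}$ is a sequence $a=a_1\cdots a_n$ of non-zero integers such that $|a_1|,\dots,|a_n|$ is a permutation of $[n]$ (each entry carries a sign $+$ or $-$). For $1\le i\le j\le n$, the reversal $\varrho_{i,j}$ changes $a$ into $a_1\cdots a_{i-1}(-a_j)(-a_{j-1})\cdots(-a_{i+1})(-a_i)a_{j+1}\cdots a_n$. The reversal distance $d_r(a)$ is the minimum number of reversals needed to transform $a$ into $e_n=12\cdots n$ (all signs positive). On the set $\{0,1,\dots,n\}\cup\{-1,-2,\dots,-n\}$ of $2n+1$ elements define the cyclic permutations (in cycle notation) $$\tilde s=(0~a_1~a_2~\cdots~a_n~-a_n~-a_{n-1}~\cdots~-a_2~-a_1),$$ $$p_r=(-1~-2~\cdots~-n+1~-n~n~n-1~\cdots~2~1~0).$$ $C(\pi)$ denotes the number of cycles of a permutation $\pi$ (fixed points included). Products of permutations are compositions of maps (right to left). *)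

theory Defs
  imports
    Complex_Main
    "HOL-Combinatorics.Cycles"
    "HOL-Combinatorics.Orbits"
    "HOL-Combinatorics.Multiset_Permutations"
begin

text \<open>
  Sequences are lists; the entry \<open>a\<^sub>i\<close> (with \<open>i \<ge> 1\<close>) is \<^term>\<open>a ! (i - 1)\<close>.
  That all entries are non-zero follows from \<open>0 \<notin> {1..n}\<close>.
\<close>

definition signed_permutation :: "nat \<Rightarrow> int list \<Rightarrow> bool" where
  "signed_permutation n a \<longleftrightarrow> map abs a \<in> permutations_of_set {1..int n}"

definition reversal :: "nat \<Rightarrow> nat \<Rightarrow> int list \<Rightarrow> int list" where
  "reversal i j a = take (i - 1) a @ map uminus (rev (drop (i - 1) (take j a))) @ drop j a"

definition reversal_step :: "int list \<Rightarrow> int list \<Rightarrow> bool" where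
  "reversal_step a b \<longleftrightarrow> (\<exists>i j. 1 \<le> i \<and> i \<le> j \<and> j \<le> length a \<and> b = reversal i j a)"

text \<open>
  The minimum is only meaningful if the identity can be reached from \<open>a\<close>;
  lemma \<open>reversals_sort\<close> below shows this for every signed permutation.
\<close>

definition reversal_distance :: "int list \<Rightarrow> nat" where
  "reversal_distance a = (LEAST k. (reversal_step ^^ k) a [1..int (length a)])"

text \<open>
  \<^term>\<open>cycle_of_list [x\<^sub>1, x\<^sub>2, x\<^sub>3]\<close> maps \<open>x\<^sub>1\<close> to \<open>x\<^sub>2\<close>, \<open>x\<^sub>2\<close> to \<open>x\<^sub>3\<close> and \<open>x\<^sub>3\<close> to \<open>x\<^sub>1\<close>,
  and is the identity elsewhere on the integers.
\<close>

definition s_tilde :: "int list \<Rightarrow> int \<Rightarrow> int" where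
  "s_tilde a = cycle_of_list (0 # a @ map uminus (rev a))"

definition p_r :: "nat \<Rightarrow> int \<Rightarrow> int" where
  "p_r n = cycle_of_list (map uminus [1..int n] @ rev [1..int n] @ [0])"

text \<open>
  The ground set is explicit because the fixed points inside it count as cycles,
  while the (infinitely many) fixed points outside it do not.
\<close>

definition num_cycles :: "'a set \<Rightarrow> ('a \<Rightarrow> 'a) \<Rightarrow> nat" where
  "num_cycles S f = card (orbit f ` S)"

lemma reversal_step_append:
  assumes "reversal_step a b"
  shows "reversal_step (a @ c) (b @ c)"
proof -
  from assms obtain i j where ij: "1 \<le> i" "i \<le> j" "j \<le> length a" "b = reversal i j a"
    unfolding reversal_step_def by blast
  then have "b @ c = reversal i j (a @ c)"
    by (simp add: reversal_def)
  with ij show ?thesis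
    unfolding reversal_step_def by (metis length_append trans_le_add1)
qed

lemma reversals_append:
  "reversal_step\<^sup>*\<^sup>* a b \<Longrightarrow> reversal_step\<^sup>*\<^sup>* (a @ c) (b @ c)"
  by (induction rule: rtranclp_induct) (auto intro: reversal_step_append rtranclp.rtrancl_into_rtrancl)

lemma reversals_sort:
  "signed_permutation n a \<Longrightarrow> reversal_step\<^sup>*\<^sup>* a [1..int n]"
proof (induction n arbitrary: a)
  case 0
  then show ?case by (simp add: signed_permutation_def)
next
  case (Suc n)
  have set_a: "abs ` set a = {1..int (Suc n)}" and dist_a: "distinct (map abs a)"
    using Suc.prems by (auto simp: signed_permutation_def permutations_of_set_def)
  have "int (Suc n) \<in> abs ` set a"
    unfolding set_a by simp
  then obtain x where x: "x \<in> set a" "\<bar>x\<bar> = int (Suc n)"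
    by auto
  then obtain u v where a: "a = u @ x # v"
    by (meson split_list)
  define w where "w = u @ map uminus (rev v)"
  have "reversal (Suc (length u)) (length a) a = w @ [-x]"
    by (simp add: reversal_def a w_def)
  then have step1: "reversal_step a (w @ [-x])"
    unfolding reversal_step_def a
    by (intro exI[of _ "Suc (length u)"] exI[of _ "length (u @ x # v)"]) simp
  have "reversal (Suc (length w)) (Suc (length w)) (w @ [-x]) = w @ [x]"
    by (simp add: reversal_def)
  then have step2: "reversal_step (w @ [-x]) (w @ [x])"
    unfolding reversal_step_def by (intro exI[of _ "Suc (length w)"]) simp
  have top: "reversal_step\<^sup>*\<^sup>* a (w @ [int (Suc n)])"
  proof (cases "x \<ge> 0")
    case True
    then have "x = int (Suc n)" using x(2) by simp
    then show ?thesis using step1 step2 by (meson converse_rtranclp_into_rtranclp r_into_rtranclp)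
  next
    case False
    then have "- x = int (Suc n)" using x(2) by simp
    then show ?thesis using step1 by auto
  qed
  have "mset (map abs w) + {#int (Suc n)#} = mset (map abs a)"
    using x(2) by (simp add: w_def a image_mset.compositionality comp_def)
  also have "\<dots> = mset_set {1..int (Suc n)}"
    using dist_a set_a by (metis mset_set_set list.set_map)
  also have "{1..int (Suc n)} = insert (int (Suc n)) {1..int n}"
    by auto
  also have "mset_set \<dots> = mset_set {1..int n} + {#int (Suc n)#}"
    by simp
  finally have "mset (map abs w) = mset_set {1..int n}"
    by simp
  then have "signed_permutation n w"
    unfolding signed_permutation_def permutations_of_set_def
    by (metis (mono_tags, lifting) finite_atLeastAtMost_int finite_set_mset_mset_set mem_Collect_eq mset_eq_mset_set_imp_distinct set_mset_mset)
  then have "reversal_step\<^sup>*\<^sup>* (w @ [int (Suc n)]) ([1..int n] @ [int (Suc n)])"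
    by (intro reversals_append Suc.IH)
  also have "[1..int n] @ [int (Suc n)] = [1..int (Suc n)]"
    by (simp add: upto_rec2)
  finally show ?case
    using top by simp
qed

end

theory Submission
  imports Defs
begin

text \<open>
  A reversal replaces the block \<open>A = a\<^sub>i \<dots> a\<^sub>j\<close> of the circular word
  \<open>0 a\<^sub>1 \<dots> a\<^sub>n -a\<^sub>n \<dots> -a\<^sub>1\<close> by its mirror image \<open>B\<close> with opposite signs, and vice versa; since both
  blocks occur in the word, it is a block interchange. Such an interchange multiplies \<open>s\<close> by
  two transpositions on the right, each of which creates at most one new cycle in \<open>p\<^sub>r \<circ> s\<close>.
  At the identity \<open>p\<^sub>r \<circ> s\<close> is trivial and has all \<open>2n + 1\<close> points as cycles.
\<close>

section \<open>Cycle counts under transpositions\<close>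

lemma orbit_eq_of_mem:
  assumes "permutation f" "y \<in> orbit f x"
  shows "orbit f x = orbit f y"
  using assms orbit_cyclic_eq3[OF cyclic_on_orbit'] by metis

text \<open>An orbit of the new map that avoids both \<open>a\<close> and \<open>b\<close> is
  already an orbit of \<open>f\<close>, and it differs from the orbit of \<open>a\<close> under
  \<open>f\<close>. So at most two orbits can be new, those of \<open>a\<close> and
  \<open>b\<close>, and at least one old orbit is lost.\<close>

lemma num_cycles_comp_transpose_le:
  assumes "finite S" "f permutes S" "a \<in> S"
  shows "num_cycles S (f \<circ> transpose a b) \<le> num_cycles S f + 1"
proof -
  let ?g = "f \<circ> transpose a b"
  have pf: "permutation f"
    using assms permutation_permutes by blast
  then have pg: "permutation ?g"
    by (simp add: permutation_compose permutation_swap_id)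
  have sub: "orbit ?g ` S \<subseteq> insert (orbit ?g a) (insert (orbit ?g b) (orbit f ` S - {orbit f a}))"
  proof
    fix O'
    assume "O' \<in> orbit ?g ` S"
    then obtain x where x: "x \<in> S" "O' = orbit ?g x"
      by blast
    show "O' \<in> insert (orbit ?g a) (insert (orbit ?g b) (orbit f ` S - {orbit f a}))"
    proof (cases "a \<in> orbit ?g x \<or> b \<in> orbit ?g x")
      case True
      then show ?thesis
        using x orbit_eq_of_mem[OF pg] by blast
    next
      case False
      have "f s = ?g s" if "s \<in> orbit ?g x" for s
        using False that by (metis comp_apply transpose_apply_other)
      then have "orbit f x = orbit ?g x"
        using orbit_cong[OF permutation_self_in_orbit[OF pg]] by metis
      moreover have "orbit f x \<noteq> orbit f a"
        using calculation False permutation_self_in_orbit[OF pf, of a] by auto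
      ultimately show ?thesis
        using x by auto
    qed
  qed
  let ?R = "orbit f ` S - {orbit f a}"
  have fin: "finite ?R"
    using assms(1) by simp
  have "card (orbit ?g ` S) \<le> card (insert (orbit ?g a) (insert (orbit ?g b) ?R))"
    using fin by (intro card_mono sub) simp
  also have "\<dots> \<le> card ?R + 2"
    using fin by (simp add: card_insert_if)
  \<comment> \<open>As \<open>a \<in> S\<close>, the removed orbit is one of those counted; this
    turns \<open>+ 2\<close> into \<open>+ 1\<close>.\<close>
  also have "\<dots> = card (orbit f ` S) + 1"
  proof -
    have "Suc (card ?R) = card (orbit f ` S)"
      using assms by (intro card_Suc_Diff1) auto
    then show ?thesis by simp
  qed
  finally show ?thesis
    by (simp add: num_cycles_def)
qed

lemma num_cycles_id: "num_cycles S id = card S"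
proof -
  have "orbit id x = {x}" for x :: 'a
    by (simp add: orbit_eq_singleton_iff)
  then show ?thesis
    by (simp add: num_cycles_def card_image)
qed

section \<open>Cutting, gluing and inverting cycles given by lists\<close>

lemma cycle_of_list_last:
  assumes "distinct q" "q \<noteq> []"
  shows "cycle_of_list q (last q) = hd q"
proof -
  have "last (map (cycle_of_list q) q) = last (rotate1 q)"
    using cyclic_rotation[OF assms(1), of 1] by simp
  moreover have "last (rotate1 q) = hd q"
    using assms(2) by (cases q) simp_all
  ultimately show ?thesis
    using assms(2) by (simp add: last_map)
qed

text \<open>Transposing one point of each of two disjoint cycles glues them. In the induction on
  \<open>p\<close> both sides share the leading transposition of \<open>p\<close>, which reduces the
  claim to a one-element \<open>p\<close>.\<close>

lemma cycle_of_list_append: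
  assumes "distinct (p @ q)" "p \<noteq> []" "q \<noteq> []"
  shows "cycle_of_list (p @ q) =
    cycle_of_list p \<circ> cycle_of_list q \<circ> transpose (last p) (last q)"
  using assms
proof (induction p rule: cycle_of_list.induct)
  case (1 i j cs)
  then show ?case
    by (simp add: comp_assoc)
next
  case ("2_2" x)
  obtain y q' where q: "q = y # q'"
    using "2_2" by (cases q) auto
  \<comment> \<open>Conjugation by the cycle of \<open>q\<close> moves the transposition to the
    left, where it becomes \<open>transpose x y\<close>, the leading factor of the cycle of
    \<open>x # y # q'\<close>.\<close>
  have "cycle_of_list q \<circ> transpose x (last q) =
      transpose (cycle_of_list q x) (cycle_of_list q (last q)) \<circ> cycle_of_list q"
    using permutes_inj[OF cycle_permutes, of q]
    by (auto simp: fun_eq_iff transpose_def inj_eq)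
  also have "cycle_of_list q x = x"
    using "2_2" by (simp add: id_outside_supp)
  also have "cycle_of_list q (last q) = y"
    using "2_2" q cycle_of_list_last[of q] by simp
  finally show ?case
    by (simp add: q)
qed simp

lemma cycle_of_list_swap_append:
  assumes "distinct (p @ q)"
  shows "cycle_of_list (p @ q) = cycle_of_list (q @ p)"
  using cycle_of_list_rotate_independent[OF assms, of "length p"] by (simp add: rotate_append)

lemma cycle_of_list_rev:
  "distinct cs \<Longrightarrow> cycle_of_list (rev cs) \<circ> cycle_of_list cs = id"
proof (induction cs rule: cycle_of_list.induct)
  case (1 i j cs)
  \<comment> \<open>\<open>rev (j # cs)\<close> ends in \<open>j\<close> and the cycle of
    \<open>[i]\<close> is the identity, so appending \<open>i\<close> adds only the factor
    \<open>transpose j i\<close>; it cancels the leading \<open>transpose i j\<close> of the other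
    cycle.\<close>
  then have "cycle_of_list (rev (j # cs) @ [i]) =
      cycle_of_list (rev (j # cs)) \<circ> transpose j i"
    by (subst cycle_of_list_append) auto
  then have "cycle_of_list (rev (i # j # cs)) \<circ> cycle_of_list (i # j # cs) =
      cycle_of_list (rev (j # cs)) \<circ> (transpose j i \<circ> transpose i j) \<circ> cycle_of_list (j # cs)"
    by (simp add: comp_assoc)
  also have "transpose j i \<circ> transpose i j = id"
    by (metis transpose_commute transpose_comp_involutory)
  finally show ?case
    using 1 by simp
qed simp_all

text \<open>Cut the cycle into those of \<open>X @ A\<close> and \<open>Y @ B\<close>, rotate these
  to \<open>A @ X\<close> and \<open>B @ Y\<close>, and glue again: the circular order becomes
  \<open>A X B Y\<close>, a rotation of \<open>X B Y A\<close>. The cut and the gluing cost one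
  transposition each. \<open>Y\<close> may be empty.\<close>

lemma cycle_of_list_block_interchange:
  assumes d: "distinct (X @ A @ Y @ B)" and ne: "X \<noteq> []" "A \<noteq> []" "B \<noteq> []"
  shows "cycle_of_list (X @ B @ Y @ A) = cycle_of_list (X @ A @ Y @ B) \<circ>
    transpose (last A) (last B) \<circ> transpose (last X) (last (B @ Y))"
proof -
  have "cycle_of_list (X @ A @ Y @ B) = cycle_of_list (X @ A) \<circ> cycle_of_list (Y @ B) \<circ>
      transpose (last A) (last B)"
    using cycle_of_list_append[of "X @ A" "Y @ B"] d ne by simp
  also have "cycle_of_list (X @ A) = cycle_of_list (A @ X)"
    using d by (intro cycle_of_list_swap_append) auto
  also have "cycle_of_list (Y @ B) = cycle_of_list (B @ Y)"
    using d by (intro cycle_of_list_swap_append) auto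
  finally have "cycle_of_list (X @ A @ Y @ B) \<circ> transpose (last A) (last B) =
      cycle_of_list (A @ X) \<circ> cycle_of_list (B @ Y)"
    by (simp add: fun_eq_iff)
  moreover have "cycle_of_list (A @ X @ B @ Y) =
      cycle_of_list (A @ X) \<circ> cycle_of_list (B @ Y) \<circ> transpose (last X) (last (B @ Y))"
    using cycle_of_list_append[of "A @ X" "B @ Y"] d ne by auto
  moreover have "cycle_of_list (A @ X @ B @ Y) = cycle_of_list (X @ B @ Y @ A)"
    using cycle_of_list_swap_append[of A "X @ B @ Y"] d by auto
  ultimately show ?thesis
    by simp
qed

section \<open>The circular word of a signed permutation and its reversals\<close>

definition doubled_word :: "int list \<Rightarrow> int list" where
  "doubled_word a = 0 # a @ map uminus (rev a)"

lemma s_tilde_doubled_word: "s_tilde a = cycle_of_list (doubled_word a)"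
  by (simp add: s_tilde_def doubled_word_def)

lemma signed_permutation_abs:
  assumes "signed_permutation n a"
  shows "abs ` set a = {1..int n}" "inj_on abs (set a)" "distinct a"
  using assms by (auto simp: signed_permutation_def permutations_of_set_def distinct_map)

text \<open>Injectivity of \<open>abs\<close> on the entries keeps \<open>x\<close> and
  \<open>- x\<close> from both occurring in \<open>a\<close>, so the two halves of the word are
  disjoint.\<close>

lemma distinct_doubled_word:
  assumes "signed_permutation n a"
  shows "distinct (doubled_word a)"
proof -
  note a = signed_permutation_abs[OF assms]
  have zero: "0 \<notin> set a"
  proof
    assume "0 \<in> set a"
    then have "\<bar>0::int\<bar> \<in> abs ` set a"
      by (rule imageI)
    then show False
      unfolding a(1) by simp
  qed
  have "- x \<notin> set a" if "x \<in> set a" for x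
  proof
    assume "- x \<in> set a"
    then have "- x = x"
      using inj_onD[OF a(2), of "- x" x] that by simp
    then show False
      using that zero by simp
  qed
  then show ?thesis
    using zero a(3) by (auto simp: doubled_word_def distinct_map image_iff)
qed

lemma set_doubled_word:
  assumes "signed_permutation n a"
  shows "set (doubled_word a) = {- int n..int n}"
proof -
  note a = signed_permutation_abs(1)[OF assms]
  have *: "x \<in> set (doubled_word a) \<longleftrightarrow> x = 0 \<or> x \<in> set a \<or> - x \<in> set a" for x
    by (auto simp: doubled_word_def image_iff minus_equation_iff[of _ x] intro: bexI[of _ "- x"])
  have "x \<in> set a \<or> - x \<in> set a \<longleftrightarrow> \<bar>x\<bar> \<in> abs ` set a" for x
    by (auto simp: image_iff abs_eq_iff intro: bexI[of _ "- x"])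
  then show ?thesis
    unfolding a using * by auto
qed

lemma length_signed_permutation:
  assumes "signed_permutation n a"
  shows "length a = n"
  using assms length_finite_permutations_of_set[of "map abs a" "{1..int n}"]
  by (simp add: signed_permutation_def)

lemma reversal_step_cases:
  assumes "reversal_step a b"
  obtains u w v where "a = u @ w @ v" "b = u @ map uminus (rev w) @ v" "w \<noteq> []"
proof -
  obtain i j where ij: "1 \<le> i" "i \<le> j" "j \<le> length a" "b = reversal i j a"
    using assms by (auto simp: reversal_step_def)
  have "take (i - 1) a @ drop (i - 1) (take j a) @ drop j a = a"
  proof -
    have "take (i - 1) a = take (i - 1) (take j a)"
      using ij by (simp add: min_absorb1)
    then show ?thesis
      by (metis append_assoc append_take_drop_id)
  qed
  moreover have "drop (i - 1) (take j a) \<noteq> []"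
    using ij by auto
  ultimately show ?thesis
    using that ij(4) unfolding reversal_def by metis
qed

lemma signed_permutation_reversal_step:
  assumes "signed_permutation n a" "reversal_step a b"
  shows "signed_permutation n b"
proof -
  obtain u w v where "a = u @ w @ v" "b = u @ map uminus (rev w) @ v"
    using assms(2) by (rule reversal_step_cases)
  then have "mset (map abs b) = mset (map abs a)"
    by (simp add: image_mset.compositionality comp_def)
  then show ?thesis
    using assms(1) unfolding signed_permutation_def permutations_of_set_def
    by (metis (mono_tags, lifting) mem_Collect_eq mset_eq_imp_distinct_iff mset_eq_setD)
qed

text \<open>Read circularly from the mirror image of \<open>u\<close> on, the word of
  \<open>a\<close> is \<open>X w Y B\<close>. Here \<open>X\<close> and \<open>Y\<close> depend only
  on \<open>u\<close> and \<open>v\<close>, so the reversal keeps them, while \<open>w\<close> and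
  its signed mirror image \<open>B\<close> trade places.\<close>

lemma s_tilde_reversal_step:
  assumes a: "signed_permutation n a" and step: "reversal_step a b"
  obtains x y z t where
    "s_tilde b = s_tilde a \<circ> transpose x y \<circ> transpose z t"
    "x \<in> {- int n..int n}" "y \<in> {- int n..int n}" "z \<in> {- int n..int n}" "t \<in> {- int n..int n}"
proof -
  obtain u w v where uwv: "a = u @ w @ v" "b = u @ map uminus (rev w) @ v" "w \<noteq> []"
    using step by (rule reversal_step_cases)
  let ?m = "\<lambda>u. map uminus (rev u) :: int list"
  \<comment> \<open>The second half of the word of \<open>b\<close> contains the mirror image of
    \<open>B\<close>, which is \<open>w\<close> again.\<close>
  have mm: "?m (?m w) = w"
    by (simp add: rev_map comp_def)
  define X where "X = ?m u @ 0 # u"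
  define Y where "Y = v @ ?m v"
  define B where "B = ?m w"
  have words: "doubled_word a = (0 # u @ w @ Y @ B) @ ?m u"
    "doubled_word b = (0 # u @ B @ Y @ w) @ ?m u"
    unfolding doubled_word_def uwv Y_def B_def using mm by simp_all
  have b: "signed_permutation n b"
    using a step by (rule signed_permutation_reversal_step)
  have da: "distinct ((0 # u @ w @ Y @ B) @ ?m u)" and db: "distinct ((0 # u @ B @ Y @ w) @ ?m u)"
    using distinct_doubled_word[OF a] distinct_doubled_word[OF b] unfolding words by simp_all
  have sa: "s_tilde a = cycle_of_list (X @ w @ Y @ B)"
    unfolding s_tilde_doubled_word words cycle_of_list_swap_append[OF da] by (simp add: X_def)
  have sb: "s_tilde b = cycle_of_list (X @ B @ Y @ w)"
    unfolding s_tilde_doubled_word words cycle_of_list_swap_append[OF db] by (simp add: X_def)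
  have ne: "X \<noteq> []" "w \<noteq> []" "B \<noteq> []"
    using uwv by (auto simp: X_def B_def)
  have "distinct (X @ w @ Y @ B)"
    using da by (auto simp: X_def)
  from cycle_of_list_block_interchange[OF this ne]
  have eq: "s_tilde b = s_tilde a \<circ> transpose (last w) (last B) \<circ> transpose (last X) (last (B @ Y))"
    by (simp add: sa sb)
  have "set (X @ w @ Y @ B) = {- int n..int n}"
    unfolding set_doubled_word[OF a, symmetric] words by (auto simp: X_def)
  moreover have "last w \<in> set w" "last B \<in> set B" "last X \<in> set X" "last (B @ Y) \<in> set (B @ Y)"
    using ne by (simp_all only: last_in_set append_is_Nil_conv simp_thms not_False_eq_True)
  ultimately have "last w \<in> {- int n..int n}" "last B \<in> {- int n..int n}"
    "last X \<in> {- int n..int n}" "last (B @ Y) \<in> {- int n..int n}"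
    unfolding set_append by blast+
  with eq show ?thesis
    by (rule that)
qed

text \<open>Shows \<open>p_r n\<close> as the inverse of \<open>s_tilde [1..int n]\<close>: it runs
  through the same circular word backwards.\<close>

lemma p_r_rev: "p_r n = cycle_of_list (rev (doubled_word [1..int n]))"
  by (simp add: p_r_def doubled_word_def rev_map)

lemma signed_permutation_upto: "signed_permutation n [1..int n]"
proof -
  have "map abs [1..int n] = [1..int n]"
    by (rule map_idI) simp
  then show ?thesis
    by (simp add: signed_permutation_def permutations_of_set_def)
qed

lemma p_r_permutes: "p_r n permutes {- int n..int n}"
  using cycle_permutes[of "rev (doubled_word [1..int n])"]
  by (simp add: p_r_rev set_doubled_word[OF signed_permutation_upto])

lemma s_tilde_permutes:
  "signed_permutation n a \<Longrightarrow> s_tilde a permutes {- int n..int n}"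
  using cycle_permutes[of "doubled_word a"] by (simp add: s_tilde_doubled_word set_doubled_word)

section \<open>Growth of the cycle count along reversals\<close>

lemma num_cycles_reversal_step_le:
  assumes a: "signed_permutation n a" and step: "reversal_step a b"
  shows "num_cycles {- int n..int n} (p_r n \<circ> s_tilde b)
    \<le> num_cycles {- int n..int n} (p_r n \<circ> s_tilde a) + 2"
proof -
  let ?S = "{- int n..int n}" and ?f = "p_r n \<circ> s_tilde a"
  obtain x y z t where eq: "s_tilde b = s_tilde a \<circ> transpose x y \<circ> transpose z t"
    and S: "x \<in> ?S" "y \<in> ?S" "z \<in> ?S" "t \<in> ?S"
    using a step by (rule s_tilde_reversal_step)
  have f: "?f permutes ?S"
    using s_tilde_permutes[OF a] p_r_permutes by (rule permutes_compose)
  then have g: "?f \<circ> transpose x y permutes ?S"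
    using S by (intro permutes_compose[OF permutes_swap_id f])
  have "num_cycles ?S (?f \<circ> transpose x y \<circ> transpose z t) \<le> num_cycles ?S ?f + 1 + 1"
    using num_cycles_comp_transpose_le[OF _ f S(1), of y]
      num_cycles_comp_transpose_le[OF _ g S(3), of t] by simp
  then show ?thesis
    by (simp add: eq comp_assoc)
qed

lemma num_cycles_reversal_steps_le:
  assumes "(reversal_step ^^ k) a b" "signed_permutation n a"
  shows "num_cycles {- int n..int n} (p_r n \<circ> s_tilde b)
    \<le> num_cycles {- int n..int n} (p_r n \<circ> s_tilde a) + 2 * k"
  using assms
proof (induction k arbitrary: a)
  case (Suc k)
  obtain c where c: "reversal_step a c" "(reversal_step ^^ k) c b"
    using Suc.prems(1) by (rule relpowp_Suc_E2)
  show ?case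
    using Suc.IH[OF c(2) signed_permutation_reversal_step[OF Suc.prems(2) c(1)]]
      num_cycles_reversal_step_le[OF Suc.prems(2) c(1)] unfolding mult_Suc_right by linarith
qed simp

lemma num_cycles_upto:
  "num_cycles {- int n..int n} (p_r n \<circ> s_tilde [1..int n]) = 2 * n + 1"
  unfolding p_r_rev s_tilde_doubled_word
    cycle_of_list_rev[OF distinct_doubled_word[OF signed_permutation_upto]]
  by (simp add: num_cycles_id)

theorem theorem7:
  fixes n :: nat and a :: "int list"
  assumes "n \<ge> 1" and "signed_permutation n a"
  shows "real (reversal_distance a)
           \<ge> (2 * real n + 1 - real (num_cycles {- int n..int n} (p_r n \<circ> s_tilde a))) / 2"
proof -
  let ?d = "reversal_distance a"
  \<comment> \<open>Reachability of the identity ensures that the \<open>LEAST\<close> in the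
    distance is attained.\<close>
  have "\<exists>k. (reversal_step ^^ k) a [1..int (length a)]"
    using reversals_sort[OF assms(2)] length_signed_permutation[OF assms(2)]
    by (simp add: rtranclp_power)
  then have "(reversal_step ^^ ?d) a [1..int (length a)]"
    unfolding reversal_distance_def by (rule LeastI_ex)
  \<comment> \<open>The count has to reach \<open>2 * n + 1\<close> at the identity and gains at
    most 2 per reversal.\<close>
  then have "2 * n + 1 \<le> num_cycles {- int n..int n} (p_r n \<circ> s_tilde a) + 2 * ?d"
    using num_cycles_reversal_steps_le[OF _ assms(2)] num_cycles_upto
      length_signed_permutation[OF assms(2)] by metis
  then have "real (2 * n + 1) \<le>
      real (num_cycles {- int n..int n} (p_r n \<circ> s_tilde a) + 2 * ?d)"
    by (rule of_nat_mono)
  then show ?thesis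
    by simp
qed

end
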